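(* Let $P\in\mathbb{R}^n$ and $\alpha>0$. Then $\bar H$ is locally Lipschitz in $\alpha$, i.e. there is a constant $C$ depending on $P,\alpha$ such that, for any $\delta$ sufficiently small, $$\frac{\bar H(P,\alpha+\delta)-\bar H(P,\alpha)}{\delta}\leq C.$$
   Context: $\mathbb{T}^n=\mathbb{R}^n/\mathbb{Z}^n$ is the unit torus. Standing assumptions on $V:\mathbb{T}^n\times\mathbb{R}\to\mathbb{R}$: $V$ is a bounded $C^1$ function, $V\ge 0$, and for every compact interval $K\subset\mathbb{R}$ there is $\gamma_K>0$ with $V(y,m)-V(y,m')\ge\gamma_K(m-m')$ for all $m\ge m'$ in $K$ and all $y\in\mathbb{T}^n$. Effective Hamiltonian: for $P\in\mathbb{R}^n$ and $\alpha\ge0$, $\bar H(P,\alpha)$ is the unique constant for which the cell problem $$-\Delta u+\tfrac12|\nabla u+P|^2-V(y,\alpha m)=\bar H(P,\alpha),\quad -\Delta m-\mathrm{div}(m(\nabla u+P))=0\ \text{ on }\mathbb{T}^n,\quad \int_{\mathbb{T}^n}u=0,\ \int_{\mathbb{T}^n}m=1$$ admits a solution $(u,m)$; this solution is unique, with $u\in C^{2,\gamma}(\mathbb{T}^n)$ for all $\gamma\in(0,1)$, $m\in W^{1,p}(\mathbb{T}^n)$ for all $p>1$, $m>0$. *)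

theory Defs
  imports "HOL-Analysis.Analysis"
begin

text \<open>
  Functions on the torus are represented by \<open>\<int>\<^sup>n\<close>-periodic functions on \<open>real ^ 'n\<close>,
  and integrals over the torus by Lebesgue integrals over the unit cube.
\<close>

definition torus_periodic :: "(real ^ 'n \<Rightarrow> 'b) \<Rightarrow> bool" where
  "torus_periodic f \<longleftrightarrow> (\<forall>x i. f (x + axis i 1) = f x)"

abbreviation torus_measure :: "(real ^ 'n) measure" where
  "torus_measure \<equiv> lebesgue_on (cbox 0 1)"

text \<open>
  In finite dimension, continuity of all directional derivatives \<open>x \<mapsto> Df(x) v\<close> is
  continuity of the derivative in operator norm.
\<close>

definition C1_function :: "('a::euclidean_space \<Rightarrow> real) \<Rightarrow> bool" where
  "C1_function f \<longleftrightarrow>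
     (\<forall>x. f differentiable (at x)) \<and>
     (\<forall>v. continuous_on UNIV (\<lambda>x. frechet_derivative f (at x) v))"

definition partial :: "'n \<Rightarrow> (real ^ 'n \<Rightarrow> real) \<Rightarrow> real ^ 'n \<Rightarrow> real" where
  "partial i f x = frechet_derivative f (at x) (axis i 1)"

definition grad :: "(real ^ 'n \<Rightarrow> real) \<Rightarrow> real ^ 'n \<Rightarrow> real ^ 'n" where
  "grad f x = (\<chi> i. partial i f x)"

definition laplacian :: "(real ^ 'n \<Rightarrow> real) \<Rightarrow> real ^ 'n \<Rightarrow> real" where
  "laplacian f x = (\<Sum>i\<in>UNIV. partial i (partial i f) x)"

text \<open>
  For periodic functions the lower-order norms are automatically finite, and Hoelder
  continuity for the Euclidean distance is the same as for the distance of the torus.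
\<close>

definition C2_hoelder_torus :: "real \<Rightarrow> (real ^ 'n \<Rightarrow> real) \<Rightarrow> bool" where
  "C2_hoelder_torus \<gamma> f \<longleftrightarrow>
     torus_periodic f \<and>
     (\<forall>x. f differentiable (at x)) \<and>
     (\<forall>i x. partial i f differentiable (at x)) \<and>
     (\<exists>L. \<forall>i j x y. \<bar>partial j (partial i f) x - partial j (partial i f) y\<bar>
                      \<le> L * dist x y powr \<gamma>)"

text \<open>
  Weak gradients are tested against \<open>C\<^sup>1\<close> functions on the torus; by density this is
  the same as testing against \<open>C\<^sup>\<infinity>\<close> functions.
\<close>

definition weak_gradient_torus ::
    "(real ^ 'n \<Rightarrow> real) \<Rightarrow> (real ^ 'n \<Rightarrow> real ^ 'n) \<Rightarrow> bool" where
  "weak_gradient_torus m g \<longleftrightarrow>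
     torus_periodic m \<and> torus_periodic g \<and>
     integrable torus_measure m \<and> integrable torus_measure g \<and>
     (\<forall>\<phi> i. torus_periodic \<phi> \<and> C1_function \<phi> \<longrightarrow>
        (LINT x|torus_measure. m x * partial i \<phi> x) =
          - (LINT x|torus_measure. g x $ i * \<phi> x))"

definition W1p_torus :: "real \<Rightarrow> (real ^ 'n \<Rightarrow> real) \<Rightarrow> bool" where
  "W1p_torus p m \<longleftrightarrow>
     integrable torus_measure (\<lambda>x. \<bar>m x\<bar> powr p) \<and>
     (\<exists>g. weak_gradient_torus m g \<and> integrable torus_measure (\<lambda>x. norm (g x) powr p))"

text \<open>
  Weak form, on the torus, of \<open>- \<Delta>m - div (m (\<nabla>u + P)) = 0\<close>.
\<close>

definition weak_fokker_planck ::
    "real ^ 'n \<Rightarrow> (real ^ 'n \<Rightarrow> real) \<Rightarrow> (real ^ 'n \<Rightarrow> real) \<Rightarrow> bool" where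
  "weak_fokker_planck P u m \<longleftrightarrow>
     (\<exists>g. weak_gradient_torus m g \<and>
        (\<forall>\<phi>. torus_periodic \<phi> \<and> C1_function \<phi> \<longrightarrow>
           (LINT x|torus_measure. (g x + m x *\<^sub>R (grad u x + P)) \<bullet> grad \<phi> x) = 0))"

text \<open>
  \<open>cell_solution V P \<alpha> c u m\<close>: the pair \<open>(u, m)\<close> solves the cell problem with constant \<open>c\<close>.
  A function in \<open>W\<^sup>1\<^sup>,\<^sup>p\<close> with \<open>p > n\<close> has a unique continuous representative; \<open>m\<close> denotes this
  representative, so that \<open>m > 0\<close> and the Hamilton-Jacobi-Bellman equation hold pointwise.
\<close>

definition cell_solution ::
    "(real ^ 'n \<Rightarrow> real \<Rightarrow> real) \<Rightarrow> real ^ 'n \<Rightarrow> real \<Rightarrow> real \<Rightarrow>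
     (real ^ 'n \<Rightarrow> real) \<Rightarrow> (real ^ 'n \<Rightarrow> real) \<Rightarrow> bool" where
  "cell_solution V P \<alpha> c u m \<longleftrightarrow>
     (\<forall>\<gamma>. 0 < \<gamma> \<and> \<gamma> < 1 \<longrightarrow> C2_hoelder_torus \<gamma> u) \<and>
     (\<forall>p>1. W1p_torus p m) \<and> continuous_on UNIV m \<and> (\<forall>y. m y > 0) \<and>
     (\<forall>y. - laplacian u y + 1/2 * (norm (grad u y + P))\<^sup>2 - V y (\<alpha> * m y) = c) \<and>
     weak_fokker_planck P u m \<and>
     (LINT y|torus_measure. u y) = 0 \<and>
     (LINT y|torus_measure. m y) = 1"

text \<open>
  \<open>H P \<alpha>\<close> is, for all \<open>P\<close> and all \<open>\<alpha> \<ge> 0\<close>, the unique constant for which the cell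
  problem is solvable. The values of \<open>H\<close> for \<open>\<alpha> < 0\<close> are irrelevant.
\<close>

definition effective_hamiltonian ::
    "(real ^ 'n \<Rightarrow> real \<Rightarrow> real) \<Rightarrow> (real ^ 'n \<Rightarrow> real \<Rightarrow> real) \<Rightarrow> bool" where
  "effective_hamiltonian V H \<longleftrightarrow>
     (\<forall>P. \<forall>\<alpha>\<ge>0.
        (\<exists>u m. cell_solution V P \<alpha> (H P \<alpha>) u m) \<and>
        (\<forall>c u m. cell_solution V P \<alpha> c u m \<longrightarrow> c = H P \<alpha>))"

end

theory Submission
  imports Defs
begin

text \<open>
  The argument is the Lasry--Lions monotonicity method, applied to the solutions
  \<open>(u\<^sub>0, m\<^sub>0)\<close> for the parameter \<open>\<alpha>\<close> and \<open>(u\<^sub>1, m\<^sub>1)\<close> for \<open>\<beta> = \<alpha> + \<delta>\<close>. Write \<open>D\<close> for the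
  difference of the two effective constants, \<open>w = u\<^sub>1 - u\<^sub>0\<close> and
  \<open>v(y) = V(y, \<beta> m\<^sub>1) - V(y, \<alpha> m\<^sub>0)\<close>. Integrating the difference of the two
  Hamilton--Jacobi equations against \<open>m\<^sub>0\<close> and using the Fokker--Planck equation of \<open>m\<^sub>0\<close>
  gives (\<open>cell_constant_difference\<close>)
  \<open>D = \<integral> m\<^sub>0 |\<nabla>w|\<^sup>2 / 2 - \<integral> m\<^sub>0 v\<close>, and, with the roles of the solutions exchanged,
  \<open>- D = \<integral> m\<^sub>1 |\<nabla>w|\<^sup>2 / 2 + \<integral> m\<^sub>1 v\<close>. Adding \<open>\<alpha>\<close> times the first identity to \<open>\<beta>\<close> times the
  second one yields
  \<open>- \<delta> D = \<integral> (\<alpha> m\<^sub>0 + \<beta> m\<^sub>1) |\<nabla>w|\<^sup>2 / 2 + \<integral> v (\<beta> m\<^sub>1 - \<alpha> m\<^sub>0)\<close>, where both integrands are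
  nonnegative, the second one because \<open>V\<close> is increasing in \<open>m\<close>. Hence each of the two integrals
  is at most \<open>|\<delta>| |D|\<close>.

  It remains to bound \<open>D\<close> by these integrals through the first identity. The gradient term
  contributes at most \<open>|\<delta>| |D| / \<alpha>\<close>, which is absorbed when \<open>|\<delta>| < \<alpha> / 2\<close>. For the other
  term, \<open>\<alpha> m\<^sub>0\<close> stays in a compact interval that does not depend on \<open>\<delta>\<close>. Since \<open>V\<close> is bounded
  and locally Lipschitz, \<open>|v| \<le> K |\<beta> m\<^sub>1 - \<alpha> m\<^sub>0|\<close> with a constant \<open>K\<close> that does not depend on
  the size of \<open>m\<^sub>1\<close> (\<open>bounded_C1_lipschitz_from_compact\<close>) and hence not on \<open>\<delta>\<close>. By monotonicity \<open>v\<^sup>2 \<le> K v (\<beta> m\<^sub>1 - \<alpha> m\<^sub>0)\<close>, and the inequality between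
  arithmetic and geometric mean bounds \<open>\<integral> m\<^sub>0 |v|\<close> by \<open>K M |\<delta>| + |D| / 4\<close>, where \<open>M\<close> bounds
  \<open>m\<^sub>0\<close>. Altogether \<open>|D| \<le> |D| / 2 + |D| / 4 + K M |\<delta>|\<close>, that is, \<open>|D| \<le> 4 K M |\<delta>|\<close>.
\<close>

section \<open>Twice continuously differentiable functions on the torus\<close>

text \<open>
  Hoelder continuity of the second derivatives enters only through their continuity. This weaker
  regularity is stable under differences without a discussion of exponents and suffices for
  integration by parts.
\<close>

definition C2_torus :: "(real ^ 'n \<Rightarrow> real) \<Rightarrow> bool" where
  "C2_torus f \<longleftrightarrow> torus_periodic f \<and> (\<forall>x. f differentiable (at x)) \<and>
     (\<forall>i x. partial i f differentiable (at x)) \<and>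
     (\<forall>i j. continuous_on UNIV (partial j (partial i f)))"

lemma C2_hoelder_torus_imp_C2_torus:
  assumes "C2_hoelder_torus \<gamma> f" and "0 < \<gamma>"
  shows "C2_torus f"
proof -
  from assms(1) obtain L where L: "\<And>i j x y. \<bar>partial j (partial i f) x - partial j (partial i f) y\<bar>
      \<le> L * dist x y powr \<gamma>"
    unfolding C2_hoelder_torus_def by blast
  have "continuous_on UNIV (partial j (partial i f))" for i j
    unfolding continuous_on_def
  proof
    fix x :: "real ^ 'a"
    have "((\<lambda>y. dist y x) \<longlongrightarrow> 0) (at x)"
      using tendsto_dist[OF tendsto_ident_at[of x UNIV] tendsto_const[of x]] by simp
    then have "((\<lambda>y. dist y x powr \<gamma>) \<longlongrightarrow> 0 powr \<gamma>) (at x)"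
      using assms(2) by (intro tendsto_powr2 tendsto_const) auto
    then have "((\<lambda>y. L * dist y x powr \<gamma>) \<longlongrightarrow> 0) (at x)"
      using tendsto_mult_right_zero by fastforce
    then have "((\<lambda>y. partial j (partial i f) y - partial j (partial i f) x) \<longlongrightarrow> 0) (at x)"
      by (rule Lim_null_comparison[rotated]) (simp add: L)
    then show "(partial j (partial i f) \<longlongrightarrow> partial j (partial i f) x) (at x)"
      by (rule LIM_zero_cancel)
  qed
  then show ?thesis
    using assms(1) unfolding C2_torus_def C2_hoelder_torus_def by blast
qed

lemma partial_diff:
  assumes "f differentiable (at x)" and "g differentiable (at x)"
  shows "partial i (\<lambda>x. f x - g x) x = partial i f x - partial i g x"
proof -
  have "((\<lambda>x. f x - g x) has_derivative
      (\<lambda>v. frechet_derivative f (at x) v - frechet_derivative g (at x) v)) (at x)"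
    using assms by (intro has_derivative_diff) (simp_all add: frechet_derivative_works)
  then show ?thesis
    unfolding partial_def using frechet_derivative_at by metis
qed

lemma partial_periodic:
  assumes per: "torus_periodic f" and diff: "\<And>x. f differentiable (at x)"
  shows "torus_periodic (partial i f)"
  unfolding torus_periodic_def partial_def
proof (intro allI)
  fix x :: "real ^ 'a" and j
  have "(f has_derivative frechet_derivative f (at (x + axis j 1))) (at (x + axis j 1))"
    using diff by (simp add: frechet_derivative_works)
  then have "((\<lambda>z. f (z + axis j 1)) has_derivative frechet_derivative f (at (x + axis j 1))) (at x)"
    by (intro has_derivative_compose[of "\<lambda>z. z + axis j 1" "\<lambda>z. z" x UNIV f, simplified])
      (auto intro!: derivative_eq_intros)
  moreover have "(\<lambda>z. f (z + axis j 1)) = f"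
    using per by (auto simp: torus_periodic_def)
  ultimately show "frechet_derivative f (at (x + axis j 1)) (axis i 1) =
      frechet_derivative f (at x) (axis i 1)"
    using frechet_derivative_at by metis
qed

lemma C1_functionI_partial:
  fixes f :: "real ^ 'n \<Rightarrow> real"
  assumes diff: "\<And>x. f differentiable (at x)" and cont: "\<And>i. continuous_on UNIV (partial i f)"
  shows "C1_function f"
proof -
  have "frechet_derivative f (at x) v = (\<Sum>i\<in>UNIV. v $ i * partial i f x)" for x v
  proof -
    have lin: "linear (frechet_derivative f (at x))"
      using diff by (rule linear_frechet_derivative)
    have "frechet_derivative f (at x) v =
        frechet_derivative f (at x) (\<Sum>i\<in>UNIV. v $ i *\<^sub>R axis i 1)"
      using basis_expansion[of v] by (simp add: scalar_mult_eq_scaleR)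
    then show ?thesis
      by (simp add: linear_sum[OF lin] linear_cmul[OF lin] partial_def)
  qed
  then show ?thesis
    unfolding C1_function_def using diff cont by (auto intro!: continuous_intros)
qed

lemma C2_torus_diff:
  assumes "C2_torus f" and "C2_torus g"
  shows "C2_torus (\<lambda>x. f x - g x)"
    and "grad (\<lambda>x. f x - g x) x = grad f x - grad g x"
    and "laplacian (\<lambda>x. f x - g x) x = laplacian f x - laplacian g x"
proof -
  have first: "partial i (\<lambda>x. f x - g x) = (\<lambda>x. partial i f x - partial i g x)" for i
    using assms by (auto simp: C2_torus_def partial_diff)
  have second: "partial j (\<lambda>x. partial i f x - partial i g x) =
      (\<lambda>x. partial j (partial i f) x - partial j (partial i g) x)" for i j
    using assms by (auto simp: C2_torus_def partial_diff)
  show "C2_torus (\<lambda>x. f x - g x)"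
    using assms by (auto simp: C2_torus_def first second torus_periodic_def
        intro!: differentiable_diff continuous_on_diff)
  show "grad (\<lambda>x. f x - g x) x = grad f x - grad g x"
    by (simp add: grad_def first vec_eq_iff)
  show "laplacian (\<lambda>x. f x - g x) x = laplacian f x - laplacian g x"
    by (simp add: laplacian_def first second sum_subtractf)
qed

lemma C2_torus_continuous_partial:
  assumes "C2_torus f"
  shows "continuous_on UNIV (partial i f)"
  using assms by (metis C2_torus_def continuous_at_imp_continuous_on differentiable_imp_continuous_within)

lemma C2_torus_continuous:
  assumes "C2_torus f"
  shows "continuous_on UNIV (grad f)" and "continuous_on UNIV (laplacian f)"
proof -
  show "continuous_on UNIV (grad f)"
    unfolding grad_def using C2_torus_continuous_partial[OF assms]
    by (intro continuous_on_vec_lambda)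
  have "continuous_on UNIV (\<lambda>x. \<Sum>i\<in>UNIV. partial i (partial i f) x)"
    using assms by (intro continuous_on_sum) (auto simp: C2_torus_def)
  then show "continuous_on UNIV (laplacian f)"
    by (simp add: laplacian_def[abs_def])
qed

lemma C2_torus_test_functions:
  assumes "C2_torus f"
  shows "torus_periodic f" and "C1_function f"
    and "torus_periodic (partial i f)" and "C1_function (partial i f)"
  using assms C2_torus_continuous_partial[OF assms]
  by (auto simp: C2_torus_def intro!: partial_periodic C1_functionI_partial)

section \<open>Integration by parts for the Fokker--Planck equation\<close>

lemma integrable_torus_continuous:
  fixes f :: "real ^ 'n \<Rightarrow> real"
  assumes "continuous_on UNIV f"
  shows "integrable torus_measure f"
  using assms by (intro continuous_imp_integrable) (rule continuous_on_subset, auto)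

lemma integrable_torus_mult_continuous:
  fixes f g :: "real ^ 'n \<Rightarrow> real"
  assumes f: "integrable torus_measure f" and g: "continuous_on UNIV g"
  shows "integrable torus_measure (\<lambda>x. f x * g x)"
proof -
  have g': "continuous_on (cbox 0 1) g"
    using g by (rule continuous_on_subset) auto
  then have "bounded (g ` cbox 0 1)"
    by (intro compact_imp_bounded compact_continuous_image) auto
  then obtain B where B: "\<And>x. x \<in> cbox 0 1 \<Longrightarrow> \<bar>g x\<bar> \<le> B"
    unfolding bounded_iff by auto
  have meas: "g \<in> borel_measurable torus_measure"
    using g' by (intro continuous_imp_measurable_on_sets_lebesgue) auto
  show ?thesis
  proof (rule Bochner_Integration.integrable_bound)
    show "integrable torus_measure (\<lambda>x. B * f x)"
      using f by simp
    show "(\<lambda>x. f x * g x) \<in> borel_measurable torus_measure"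
      using f meas by (intro borel_measurable_times) auto
    show "AE x in torus_measure. norm (f x * g x) \<le> norm (B * f x)"
    proof (rule AE_I2)
      fix x :: "real ^ 'n"
      assume "x \<in> space torus_measure"
      then have "\<bar>g x\<bar> \<le> \<bar>B\<bar>"
        using B[of x] by (simp add: space_restrict_space)
      then show "norm (f x * g x) \<le> norm (B * f x)"
        using mult_left_mono[of "\<bar>g x\<bar>" "\<bar>B\<bar>" "\<bar>f x\<bar>"] by (simp add: abs_mult mult.commute)
    qed
  qed
qed

text \<open>
  The weak gradient of \<open>m\<close> is tested against each \<open>\<partial>\<^sub>i w\<close>, which turns \<open>\<integral> m \<Delta>w\<close> into
  \<open>- \<integral> \<nabla>m \<bullet> \<nabla>w\<close>; the Fokker--Planck equation tested against \<open>w\<close> then replaces the diffusion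
  term by the drift term.
\<close>

lemma fokker_planck_integral_laplacian:
  assumes fp: "weak_fokker_planck P u m" and m: "continuous_on UNIV m"
    and u: "C2_torus u" and w: "C2_torus w"
  shows "(LINT x|torus_measure. m x * laplacian w x) =
    (LINT x|torus_measure. m x * ((grad u x + P) \<bullet> grad w x))"
proof -
  from fp obtain g where g: "weak_gradient_torus m g"
    and eq: "\<And>\<phi>. torus_periodic \<phi> \<Longrightarrow> C1_function \<phi> \<Longrightarrow>
      (LINT x|torus_measure. (g x + m x *\<^sub>R (grad u x + P)) \<bullet> grad \<phi> x) = 0"
    unfolding weak_fokker_planck_def by blast
  note cont = C2_torus_continuous[OF u] C2_torus_continuous[OF w] m
  have int_gi: "integrable torus_measure (\<lambda>x. g x $ i)" for i
    using g by (intro integrable_bounded_linear[OF bounded_linear_vec_nth])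
      (simp add: weak_gradient_torus_def)
  have int_gp: "integrable torus_measure (\<lambda>x. g x $ i * partial i w x)" for i
    by (intro integrable_torus_mult_continuous int_gi C2_torus_continuous_partial w)
  have inner_g: "g x \<bullet> grad w x = (\<Sum>i\<in>UNIV. g x $ i * partial i w x)" for x
    by (simp add: inner_vec_def grad_def)
  have int_g: "integrable torus_measure (\<lambda>x. g x \<bullet> grad w x)"
    unfolding inner_g using int_gp by (intro Bochner_Integration.integrable_sum)
  have int_m: "integrable torus_measure (\<lambda>x. m x * ((grad u x + P) \<bullet> grad w x))"
    by (intro integrable_torus_continuous continuous_intros cont)
  have int_mp: "integrable torus_measure (\<lambda>x. m x * partial i (partial i w) x)" for i
    using w by (intro integrable_torus_continuous continuous_intros m) (simp add: C2_torus_def)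
  have "(LINT x|torus_measure. m x * laplacian w x) =
      (\<Sum>i\<in>UNIV. LINT x|torus_measure. m x * partial i (partial i w) x)"
    using int_mp by (simp add: laplacian_def sum_distrib_left)
  also have "\<dots> = (\<Sum>i\<in>UNIV. - (LINT x|torus_measure. g x $ i * partial i w x))"
    using g C2_torus_test_functions[OF w] by (intro sum.cong) (auto simp: weak_gradient_torus_def)
  also have "\<dots> = - (LINT x|torus_measure. g x \<bullet> grad w x)"
    unfolding inner_g using int_gp by (simp add: sum_negf)
  also have "\<dots> = (LINT x|torus_measure. m x * ((grad u x + P) \<bullet> grad w x))"
  proof -
    have "(LINT x|torus_measure. g x \<bullet> grad w x + m x * ((grad u x + P) \<bullet> grad w x)) = 0"
      using eq[OF C2_torus_test_functions(1,2)[OF w]] by (simp add: inner_add_left)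
    then show ?thesis
      using Bochner_Integration.integral_add[OF int_g int_m] by simp
  qed
  finally show ?thesis .
qed

section \<open>Comparison of two solutions of the cell problem\<close>

lemma cell_solutionD:
  assumes "cell_solution V P a c u m"
  shows "C2_torus u" and "continuous_on UNIV m" and "m y > 0"
    and "- laplacian u y + 1/2 * (norm (grad u y + P))\<^sup>2 - V y (a * m y) = c"
    and "weak_fokker_planck P u m" and "(LINT y|torus_measure. m y) = 1"
proof -
  have "C2_hoelder_torus (1/2) u"
    using assms unfolding cell_solution_def by simp
  then show "C2_torus u"
    by (rule C2_hoelder_torus_imp_C2_torus) simp
qed (use assms in \<open>auto simp: cell_solution_def\<close>)

lemma continuous_on_potential:
  fixes V :: "'a::topological_space \<Rightarrow> real \<Rightarrow> real"
  assumes V: "continuous_on UNIV (\<lambda>(y, s). V y s)" and m: "continuous_on UNIV m"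
  shows "continuous_on UNIV (\<lambda>y. V y (k * m y))"
proof -
  have "continuous_on UNIV (\<lambda>y. (y, k * m y))"
    by (intro continuous_intros m)
  from continuous_on_compose2[OF V this] show ?thesis by simp
qed

text \<open>
  Convexity of the Hamiltonian in exact form: \<open>|q\<^sub>1|\<^sup>2 / 2 - |q\<^sub>0|\<^sup>2 / 2\<close> is the linearisation
  \<open>q\<^sub>0 \<bullet> (q\<^sub>1 - q\<^sub>0)\<close> plus \<open>|q\<^sub>1 - q\<^sub>0|\<^sup>2 / 2\<close>. Integrated against \<open>m\<^sub>0\<close>, the linearised part cancels
  the Laplacian of \<open>u\<^sub>1 - u\<^sub>0\<close> by the Fokker--Planck equation of \<open>m\<^sub>0\<close>.
\<close>

lemma cell_constant_difference:
  assumes V: "continuous_on UNIV (\<lambda>(y, s). V y s)"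
    and s0: "cell_solution V P a c0 u0 m0" and s1: "cell_solution V P b c1 u1 m1"
  shows "c1 - c0 = (LINT y|torus_measure. m0 y * ((norm (grad u1 y - grad u0 y))\<^sup>2 / 2))
    - (LINT y|torus_measure. m0 y * (V y (b * m1 y) - V y (a * m0 y)))"
proof -
  define w where "w = (\<lambda>x. u1 x - u0 x)"
  note d0 = cell_solutionD[OF s0] and d1 = cell_solutionD[OF s1]
  have w: "C2_torus w"
    and gw: "grad w y = grad u1 y - grad u0 y"
    and lw: "laplacian w y = laplacian u1 y - laplacian u0 y" for y
    unfolding w_def using C2_torus_diff[OF d1(1) d0(1)] by auto
  note cont = C2_torus_continuous[OF d0(1)] C2_torus_continuous[OF d1(1)] C2_torus_continuous[OF w]
    d0(2) d1(2)
  note contV = continuous_on_potential[OF V]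
  have pointwise: "c1 - c0 = - laplacian w y + (grad u0 y + P) \<bullet> grad w y
      + (norm (grad w y))\<^sup>2 / 2 - (V y (b * m1 y) - V y (a * m0 y))" for y
  proof -
    have "1/2 * (norm (grad u1 y + P))\<^sup>2 - 1/2 * (norm (grad u0 y + P))\<^sup>2 =
        (grad u0 y + P) \<bullet> grad w y + (norm (grad w y))\<^sup>2 / 2"
      unfolding gw power2_norm_eq_inner
      by (simp add: inner_simps inner_commute field_simps)
    then show ?thesis
      using d0(4)[of y] d1(4)[of y] lw[of y] by simp
  qed
  define A where "A y = m0 y * laplacian w y" for y
  define B where "B y = m0 y * ((grad u0 y + P) \<bullet> grad w y)" for y
  define E where "E y = m0 y * ((norm (grad w y))\<^sup>2 / 2)" for y
  define F where "F y = m0 y * (V y (b * m1 y) - V y (a * m0 y))" for y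
  have ints: "integrable torus_measure A" "integrable torus_measure B"
      "integrable torus_measure E" "integrable torus_measure F"
    unfolding A_def B_def E_def F_def
    by (intro integrable_torus_continuous continuous_intros cont contV; simp)+
  have "c1 - c0 = (LINT y|torus_measure. m0 y * (c1 - c0))"
    using d0(6) by simp
  also have "(\<lambda>y. m0 y * (c1 - c0)) = (\<lambda>y. B y - A y + E y - F y)"
  proof
    fix y
    show "m0 y * (c1 - c0) = B y - A y + E y - F y"
      unfolding pointwise[of y] A_def B_def E_def F_def by (simp add: algebra_simps)
  qed
  also have "integral\<^sup>L torus_measure (\<lambda>y. B y - A y + E y - F y) = integral\<^sup>L torus_measure B
      - integral\<^sup>L torus_measure A + integral\<^sup>L torus_measure E - integral\<^sup>L torus_measure F"
    using ints by simp
  also have "integral\<^sup>L torus_measure A = integral\<^sup>L torus_measure B"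
    using fokker_planck_integral_laplacian[OF d0(5,2,1) w] by (simp add: A_def[abs_def] B_def[abs_def])
  finally show ?thesis
    by (simp add: E_def[abs_def] F_def[abs_def] gw)
qed

section \<open>The potential\<close>

lemma C1_function_continuous_on:
  assumes "C1_function f"
  shows "continuous_on UNIV f"
  using assms by (auto simp: C1_function_def intro!: continuous_at_imp_continuous_on
      differentiable_imp_continuous_within)

text \<open>
  Only one of the two points is confined to a compact interval: if the other one is far away, then
  the distance is at least \<open>1\<close> and boundedness of \<open>V\<close> takes over from its derivative.
\<close>

lemma bounded_C1_lipschitz_from_compact:
  fixes V :: "real ^ 'n \<Rightarrow> real \<Rightarrow> real"
  assumes bdd: "\<exists>B. \<forall>y s. \<bar>V y s\<bar> \<le> B" and C1: "C1_function (\<lambda>(y, s). V y s)"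
    and S: "compact S"
  shows "\<exists>K>0. \<forall>y\<in>S. \<forall>s\<in>{0..R}. \<forall>s'\<ge>0. \<bar>V y s' - V y s\<bar> \<le> K * \<bar>s' - s\<bar>"
proof -
  obtain B where B: "\<And>y s. \<bar>V y s\<bar> \<le> B"
    using bdd by blast
  define F where "F = (\<lambda>(y, s). V y s)"
  define DV where "DV p = frechet_derivative F (at p) (0, 1)" for p
  have F: "(F has_derivative frechet_derivative F (at p)) (at p)" for p
  proof -
    have "F differentiable (at p)"
      using C1 unfolding F_def C1_function_def by blast
    then show ?thesis
      by (simp add: frechet_derivative_works)
  qed
  have deriv: "(V y has_real_derivative DV (y, s)) (at s)" for y s
  proof -
    have "((\<lambda>s. F (y, s)) has_derivative (\<lambda>t. frechet_derivative F (at (y, s)) (0, t))) (at s)"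
      by (rule has_derivative_compose[of "\<lambda>s. (y, s)" "\<lambda>t. (0, t)" s UNIV F])
        (auto intro!: derivative_eq_intros F)
    moreover have "frechet_derivative F (at (y, s)) (0, t) = t * DV (y, s)" for t
    proof -
      have "linear (frechet_derivative F (at (y, s)))"
        using F has_derivative_linear by blast
      from linear_cmul[OF this, of t "(0, 1)"] show ?thesis
        by (simp add: DV_def)
    qed
    ultimately show ?thesis
      by (simp add: F_def has_field_derivative_def mult_commute_abs)
  qed
  have "continuous_on UNIV DV"
    using C1 unfolding C1_function_def F_def DV_def[abs_def] by blast
  then have "bounded (DV ` (S \<times> {0..R + 1}))"
    using S by (intro compact_imp_bounded compact_continuous_image compact_Times)
      (auto intro: continuous_on_subset)
  then obtain L where L: "\<And>y s. y \<in> S \<Longrightarrow> s \<in> {0..R + 1} \<Longrightarrow> \<bar>DV (y, s)\<bar> \<le> L"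
    unfolding bounded_iff by (fastforce simp: image_iff)
  define K where "K = \<bar>L\<bar> + 2 * \<bar>B\<bar> + 1"
  have "\<bar>V y s' - V y s\<bar> \<le> K * \<bar>s' - s\<bar>" if y: "y \<in> S" and s: "s \<in> {0..R}" and s': "0 \<le> s'" for y s s'
  proof (cases "s' \<le> R + 1")
    case True
    have "norm (V y s' - V y s) \<le> K * norm (s' - s)"
    proof (rule field_differentiable_bound[where S = "{0..R + 1}" and f' = "\<lambda>s. DV (y, s)"])
      show "(V y has_field_derivative DV (y, z)) (at z within {0..R + 1})" for z
        using deriv by (rule has_field_derivative_at_within)
      show "norm (DV (y, z)) \<le> K" if "z \<in> {0..R + 1}" for z
        using L[OF y that] by (simp add: K_def)
    qed (use True s s' in auto)
    then show ?thesis by simp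
  next
    case False
    have "\<bar>V y s' - V y s\<bar> \<le> K * 1"
      using B[of y s'] B[of y s] by (simp add: K_def)
    also have "\<dots> \<le> K * \<bar>s' - s\<bar>"
      using False s by (intro mult_left_mono) (auto simp: K_def)
    finally show ?thesis .
  qed
  moreover have "K > 0"
    by (simp add: K_def)
  ultimately show ?thesis by blast
qed

text \<open>
  Young's inequality with the weight \<open>K d\<close>, in which \<open>v\<^sup>2 \<le> K v t\<close> replaces the square by the
  product that the monotonicity identity controls.
\<close>

lemma abs_le_of_lipschitz_monotone:
  fixes v t K d :: real
  assumes K: "K > 0" and d: "d > 0" and lip: "\<bar>v\<bar> \<le> K * \<bar>t\<bar>" and mono: "v * t \<ge> 0"
  shows "\<bar>v\<bar> \<le> K * d + v * t / (4 * d)"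
proof -
  have "\<bar>v\<bar> * \<bar>v\<bar> \<le> \<bar>v\<bar> * (K * \<bar>t\<bar>)"
    using lip by (intro mult_left_mono) auto
  also have "\<dots> = K * (v * t)"
    using mono by (simp add: abs_mult[symmetric] mult.left_commute)
  finally have sq: "\<bar>v\<bar>\<^sup>2 \<le> K * (v * t)"
    by (simp add: power2_eq_square)
  have "0 \<le> (\<bar>v\<bar> - 2 * K * d)\<^sup>2"
    by simp
  then have "K * (\<bar>v\<bar> * (4 * d)) \<le> K * (K * d * (4 * d) + v * t)"
    using sq by (simp add: power2_eq_square algebra_simps)
  then have "\<bar>v\<bar> * (4 * d) \<le> K * d * (4 * d) + v * t"
    using K by simp
  then show ?thesis
    using d by (simp add: field_simps)
qed

section \<open>Lipschitz dependence of the effective Hamiltonian on the congestion parameter\<close>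

text \<open>
  The constant sees the first solution only through the bound \<open>M\<close> and the second one not at all;
  this is what makes the estimate uniform in \<open>\<delta>\<close>.
\<close>

lemma cell_constant_lipschitz:
  fixes V :: "real ^ 'n \<Rightarrow> real \<Rightarrow> real"
  assumes V: "continuous_on UNIV (\<lambda>(y, s). V y s)"
    and mono: "\<And>y s s'. s' \<le> s \<Longrightarrow> V y s' \<le> V y s"
    and K: "K > 0" and lip: "\<And>y s s'. y \<in> cbox 0 1 \<Longrightarrow> s \<in> {0..\<alpha> * M} \<Longrightarrow> 0 \<le> s' \<Longrightarrow>
      \<bar>V y s' - V y s\<bar> \<le> K * \<bar>s' - s\<bar>"
    and s0: "cell_solution V P \<alpha> c0 u0 m0" and s1: "cell_solution V P (\<alpha> + \<delta>) c1 u1 m1"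
    and M: "M > 0" "\<And>y. y \<in> cbox 0 1 \<Longrightarrow> m0 y \<le> M"
    and \<alpha>: "\<alpha> > 0" and \<delta>: "\<delta> \<noteq> 0" "\<bar>\<delta>\<bar> < \<alpha> / 2"
  shows "\<bar>c1 - c0\<bar> \<le> 4 * K * M * \<bar>\<delta>\<bar>"
proof -
  define \<beta> where "\<beta> = \<alpha> + \<delta>"
  have \<beta>: "\<beta> > 0"
    using \<alpha> \<delta>(2) by (simp add: \<beta>_def)
  note d0 = cell_solutionD[OF s0] and d1 = cell_solutionD[OF s1[folded \<beta>_def]]
  define v where "v y = V y (\<beta> * m1 y) - V y (\<alpha> * m0 y)" for y
  define t where "t y = \<beta> * m1 y - \<alpha> * m0 y" for y
  define e where "e y = (norm (grad u1 y - grad u0 y))\<^sup>2 / 2" for y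
  define D where "D = c1 - c0"
  note contV = continuous_on_potential[OF V]
  have cv: "continuous_on UNIV v" and ct: "continuous_on UNIV t" and ce: "continuous_on UNIV e"
    unfolding v_def t_def e_def
    by (intro continuous_intros contV d0 d1 C2_torus_continuous; simp)+
  note cont = cv ct ce d0(2) d1(2)
  note int = integrable_torus_continuous
  have D0: "D = (LINT y|torus_measure. m0 y * e y) - (LINT y|torus_measure. m0 y * v y)"
    using cell_constant_difference[OF V s0 s1] by (simp add: D_def e_def v_def \<beta>_def)
  have D1: "- D = (LINT y|torus_measure. m1 y * e y) + (LINT y|torus_measure. m1 y * v y)"
  proof -
    have "- D = (LINT y|torus_measure. m1 y * e y) - (LINT y|torus_measure. m1 y * (- v y))"
      using cell_constant_difference[OF V s1 s0]
      by (simp add: D_def e_def v_def \<beta>_def norm_minus_commute)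
    then show ?thesis by simp
  qed
  have vt: "v y * t y \<ge> 0" for y
  proof (cases "\<alpha> * m0 y \<le> \<beta> * m1 y")
    case True
    then show ?thesis
      using mono[OF True, of y] by (simp add: v_def t_def)
  next
    case False
    then show ?thesis
      using mono[of "\<beta> * m1 y" "\<alpha> * m0 y" y] by (simp add: v_def t_def mult_nonpos_nonpos)
  qed
  have E0: "(LINT y|torus_measure. m0 y * e y) \<ge> 0" and E1: "(LINT y|torus_measure. m1 y * e y) \<ge> 0"
    using d0(3) d1(3) by (auto intro!: Bochner_Integration.integral_nonneg simp: e_def less_imp_le)
  have T: "(LINT y|torus_measure. v y * t y) \<ge> 0"
    using vt by (intro Bochner_Integration.integral_nonneg) auto
  have T_eq: "(LINT y|torus_measure. v y * t y) =
      \<beta> * (LINT y|torus_measure. m1 y * v y) - \<alpha> * (LINT y|torus_measure. m0 y * v y)"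
  proof -
    have "(LINT y|torus_measure. v y * t y) =
        (LINT y|torus_measure. \<beta> * (m1 y * v y) - \<alpha> * (m0 y * v y))"
      by (simp add: t_def algebra_simps)
    also have "\<dots> = \<beta> * (LINT y|torus_measure. m1 y * v y) - \<alpha> * (LINT y|torus_measure. m0 y * v y)"
      by (subst Bochner_Integration.integral_diff) (auto intro!: int continuous_intros cont)
    finally show ?thesis .
  qed
  have energy: "\<alpha> * (LINT y|torus_measure. m0 y * e y) + \<beta> * (LINT y|torus_measure. m1 y * e y)
      + (LINT y|torus_measure. v y * t y) = - (\<delta> * D)"
  proof -
    have "- (\<delta> * D) = \<alpha> * D + \<beta> * (- D)"
      by (simp add: \<beta>_def algebra_simps)
    then show ?thesis
      unfolding T_eq by (subst (asm) D1, subst (asm) D0) (simp add: algebra_simps)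
  qed
  have \<delta>D: "- (\<delta> * D) \<le> \<bar>\<delta>\<bar> * \<bar>D\<bar>"
    by (simp add: abs_mult[symmetric])
  have E0_le: "(LINT y|torus_measure. m0 y * e y) \<le> \<bar>D\<bar> / 2"
  proof -
    have "\<alpha> * (LINT y|torus_measure. m0 y * e y) \<le> \<bar>\<delta>\<bar> * \<bar>D\<bar>"
      using energy \<delta>D T mult_nonneg_nonneg[OF less_imp_le[OF \<beta>] E1] by linarith
    also have "\<dots> \<le> \<alpha> / 2 * \<bar>D\<bar>"
      using \<delta>(2) by (intro mult_right_mono) auto
    finally show ?thesis
      using \<alpha> by (simp add: field_simps)
  qed
  have T_le: "(LINT y|torus_measure. v y * t y) \<le> \<bar>\<delta>\<bar> * \<bar>D\<bar>"
    using energy \<delta>D mult_nonneg_nonneg[OF less_imp_le[OF \<alpha>] E0]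
      mult_nonneg_nonneg[OF less_imp_le[OF \<beta>] E1] by linarith
  have pointwise: "m0 y * \<bar>v y\<bar> \<le> K * M * \<bar>\<delta>\<bar> * m0 y + v y * t y / (4 * \<bar>\<delta>\<bar>)"
    if y: "y \<in> cbox 0 1" for y
  proof -
    have "\<bar>v y\<bar> \<le> K * \<bar>t y\<bar>"
      unfolding v_def t_def using d0(3)[of y] d1(3)[of y] M(2)[OF y] \<alpha> \<beta>
      by (intro lip y) auto
    \<comment> \<open>The weight \<open>M |\<delta>|\<close> makes the factor \<open>m\<^sub>0 \<le> M\<close> cancel in the second term.\<close>
    then have "\<bar>v y\<bar> \<le> K * (M * \<bar>\<delta>\<bar>) + v y * t y / (4 * (M * \<bar>\<delta>\<bar>))"
      using K M(1) \<delta>(1) vt by (intro abs_le_of_lipschitz_monotone) auto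
    then have "m0 y * \<bar>v y\<bar> \<le> m0 y * (K * (M * \<bar>\<delta>\<bar>) + v y * t y / (4 * (M * \<bar>\<delta>\<bar>)))"
      using d0(3)[of y] by (intro mult_left_mono) auto
    also have "\<dots> = K * M * \<bar>\<delta>\<bar> * m0 y + m0 y * (v y * t y / (4 * (M * \<bar>\<delta>\<bar>)))"
      by (simp add: algebra_simps)
    also have "m0 y * (v y * t y / (4 * (M * \<bar>\<delta>\<bar>))) \<le> M * (v y * t y / (4 * (M * \<bar>\<delta>\<bar>)))"
      using M vt[of y] y by (intro mult_right_mono) auto
    also have "\<dots> = v y * t y / (4 * \<bar>\<delta>\<bar>)"
      using M(1) by simp
    finally show ?thesis by simp
  qed
  have "\<bar>LINT y|torus_measure. m0 y * v y\<bar> \<le> (LINT y|torus_measure. \<bar>m0 y * v y\<bar>)"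
    by (rule integral_abs_bound)
  also have "\<dots> = (LINT y|torus_measure. m0 y * \<bar>v y\<bar>)"
    using d0(3) by (simp add: abs_mult abs_of_pos)
  also have "\<dots> \<le> (LINT y|torus_measure. K * M * \<bar>\<delta>\<bar> * m0 y + v y * t y / (4 * \<bar>\<delta>\<bar>))"
    using pointwise \<delta>(1)
    by (intro integral_mono int continuous_intros cont) (auto simp: space_restrict_space)
  also have "\<dots> = K * M * \<bar>\<delta>\<bar> + (LINT y|torus_measure. v y * t y) / (4 * \<bar>\<delta>\<bar>)"
    using d0(6) \<delta>(1)
    by (subst Bochner_Integration.integral_add) (auto intro!: int continuous_intros cont)
  also have "\<dots> \<le> K * M * \<bar>\<delta>\<bar> + \<bar>\<delta>\<bar> * \<bar>D\<bar> / (4 * \<bar>\<delta>\<bar>)"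
    using T_le by (intro add_left_mono divide_right_mono) auto
  also have "\<dots> = K * M * \<bar>\<delta>\<bar> + \<bar>D\<bar> / 4"
    using \<delta>(1) by simp
  finally have "\<bar>LINT y|torus_measure. m0 y * v y\<bar> \<le> K * M * \<bar>\<delta>\<bar> + \<bar>D\<bar> / 4" .
  then have "\<bar>D\<bar> \<le> \<bar>D\<bar> / 2 + (K * M * \<bar>\<delta>\<bar> + \<bar>D\<bar> / 4)"
    using D0 E0 E0_le by linarith
  then show ?thesis
    by (simp add: D_def)
qed

theorem lemma5p4:
  fixes V :: "real ^ 'n \<Rightarrow> real \<Rightarrow> real"
    and H :: "real ^ 'n \<Rightarrow> real \<Rightarrow> real"
    and P :: "real ^ 'n" and \<alpha> :: real
  assumes V_periodic: "\<And>s. torus_periodic (\<lambda>y. V y s)"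
    and V_bounded: "\<exists>B. \<forall>y s. \<bar>V y s\<bar> \<le> B"
    and V_C1: "C1_function (\<lambda>(y, s). V y s)"
    and V_nonneg: "\<And>y s. V y s \<ge> 0"
    and V_mono: "\<And>a b. a \<le> b \<Longrightarrow>
      \<exists>\<gamma>>0. \<forall>y. \<forall>s\<in>{a..b}. \<forall>s'\<in>{a..b}. s' \<le> s \<longrightarrow> V y s - V y s' \<ge> \<gamma> * (s - s')"
    and H: "effective_hamiltonian V H"
    and \<alpha>_pos: "\<alpha> > 0"
  shows "\<exists>C. \<exists>\<epsilon>>0. \<forall>\<delta>. \<delta> \<noteq> 0 \<and> \<bar>\<delta>\<bar> < \<epsilon> \<longrightarrow>
           \<bar>(H P (\<alpha> + \<delta>) - H P \<alpha>) / \<delta>\<bar> \<le> C"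
proof -
  have mono: "V y s' \<le> V y s" if "s' \<le> s" for y s s'
  proof -
    obtain \<gamma> where \<gamma>: "\<gamma> > 0" "\<forall>y. \<forall>r\<in>{s'..s}. \<forall>r'\<in>{s'..s}. r' \<le> r \<longrightarrow> V y r - V y r' \<ge> \<gamma> * (r - r')"
      using V_mono[OF \<open>s' \<le> s\<close>] by blast
    then have "\<gamma> * (s - s') \<le> V y s - V y s'"
      using that by simp
    with \<gamma>(1) show ?thesis
      using that by (smt (verit) mult_nonneg_nonneg)
  qed
  have ex: "\<exists>u m. cell_solution V P a (H P a) u m" if "a \<ge> 0" for a
    using H that unfolding effective_hamiltonian_def by blast
  obtain u0 m0 where s0: "cell_solution V P \<alpha> (H P \<alpha>) u0 m0"
    using ex[of \<alpha>] \<alpha>_pos by auto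
  have "continuous_on (cbox 0 1) m0"
    using cell_solutionD(2)[OF s0] by (rule continuous_on_subset) auto
  then have "bounded (m0 ` cbox 0 1)"
    by (intro compact_imp_bounded compact_continuous_image) auto
  then obtain M where M: "M > 0" "\<And>y. y \<in> cbox 0 1 \<Longrightarrow> m0 y \<le> M"
    unfolding bounded_pos by (auto simp: abs_le_iff)
  obtain K where K: "K > 0" "\<And>y s s'. y \<in> cbox 0 1 \<Longrightarrow> s \<in> {0..\<alpha> * M} \<Longrightarrow> 0 \<le> s' \<Longrightarrow>
      \<bar>V y s' - V y s\<bar> \<le> K * \<bar>s' - s\<bar>"
    using bounded_C1_lipschitz_from_compact[OF V_bounded V_C1 compact_cbox, of 0 1 "\<alpha> * M"] by blast
  have "\<bar>(H P (\<alpha> + \<delta>) - H P \<alpha>) / \<delta>\<bar> \<le> 4 * K * M" if \<delta>: "\<delta> \<noteq> 0" "\<bar>\<delta>\<bar> < \<alpha> / 2" for \<delta>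
  proof -
    obtain u1 m1 where s1: "cell_solution V P (\<alpha> + \<delta>) (H P (\<alpha> + \<delta>)) u1 m1"
      using ex[of "\<alpha> + \<delta>"] \<delta>(2) \<alpha>_pos by fastforce
    have "\<bar>H P (\<alpha> + \<delta>) - H P \<alpha>\<bar> \<le> 4 * K * M * \<bar>\<delta>\<bar>"
      using C1_function_continuous_on[OF V_C1] mono K s0 s1 M \<alpha>_pos \<delta>
      by (rule cell_constant_lipschitz)
    then show ?thesis
      using \<delta>(1) by (simp add: divide_le_eq)
  qed
  then show ?thesis
    using \<alpha>_pos by (intro exI[of _ "4 * K * M"] exI[of _ "\<alpha> / 2"]) auto
qed

end
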